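(* Let $\mathcal{A},\mathcal{B}$ be (strict) tensor categories over a field $k$ and let $\mathcal{U}:\mathcal{A}\to\mathcal{B}$ be a $k$-linear, exact, faithful monoidal functor which has a left adjoint. Then the full subcategory $\mathrm{Proj}_{\mathcal{A},\mathcal{B}}$ of relatively projective objects is a tensor ideal in $\mathcal{A}$ (i.e. for $P$ relatively projective and any $V\in\mathcal{A}$, both $P\otimes V$ and $V\otimes P$ are relatively projective), and it is stable under the duality functors $P\mapsto P^\vee$ and $P\mapsto{}^\vee P$.
   Context: A tensor category over $k$ is a $k$-linear abelian rigid monoidal category with $k$-bilinear tensor product whose unit $\mathbf{1}$ is simple with $\mathrm{End}(\mathbf{1})\cong k$. The duals of $X$ are $X^\vee$, with $\mathrm{ev}_X:X^\vee\otimes X\to\mathbf{1}$ and $\mathrm{coev}_X:\mathbf{1}\to X\otimes X^\vee$, and ${}^\vee X$, with $\widetilde{\mathrm{ev}}_X:X\otimes{}^\vee X\to\mathbf{1}$ and $\widetilde{\mathrm{coev}}_X:\mathbf{1}\to{}^\vee X\otimes X$. A morphism $f:X\to Y$ in $\mathcal{A}$ is allowable if there is $s\in\mathrm{Hom}_{\mathcal{B}}(\mathcal{U}(Y),\mathcal{U}(X))$ with $\mathcal{U}(f)s\,\mathcal{U}(f)=\mathcal{U}(f)$. An object $P\in\mathcal{A}$ is relatively projective if for every allowable epimorphism $f:X\to Y$ in $\mathcal{A}$ and every $g:P\to Y$ there is $h:P\to X$ with $fh=g$. *)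

theory Defs
  imports "HOL-Algebra.Module" "HOL-Algebra.QuotRing"
begin

section \<open>Categories\<close>

text \<open>
  A category consists of a set of objects and a set of arrows, each arrow knowing its source and
  target (so that distinct hom-sets are disjoint). Composition is written in the usual order:
  \<open>g \<cdot> f\<close> is \<open>f\<close> followed by \<open>g\<close>. All operations are relevant on objects and on (composable) arrows
  only; their values elsewhere are unconstrained.
\<close>

record ('o, 'm) category_data =
  objects :: "'o set"
  arrows :: "'m set"
  src :: "'m \<Rightarrow> 'o"
  tgt :: "'m \<Rightarrow> 'o"
  ident :: "'o \<Rightarrow> 'm"
  comp_arr :: "'m \<Rightarrow> 'm \<Rightarrow> 'm"  (infixr \<open>\<cdot>\<index>\<close> 68)

definition Hom :: "('o, 'm, 'z) category_data_scheme \<Rightarrow> 'o \<Rightarrow> 'o \<Rightarrow> 'm set" where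
  "Hom C X Y = {f \<in> arrows C. src C f = X \<and> tgt C f = Y}"

locale category =
  fixes C :: "('o, 'm, 'z) category_data_scheme" (structure)
  assumes src_closed: "f \<in> arrows C \<Longrightarrow> src C f \<in> objects C"
    and tgt_closed: "f \<in> arrows C \<Longrightarrow> tgt C f \<in> objects C"
    and ident_closed: "X \<in> objects C \<Longrightarrow> ident C X \<in> Hom C X X"
    and comp_closed: "\<lbrakk>f \<in> Hom C X Y; g \<in> Hom C Y Z\<rbrakk> \<Longrightarrow> g \<cdot> f \<in> Hom C X Z"
    and ident_left: "f \<in> Hom C X Y \<Longrightarrow> ident C Y \<cdot> f = f"
    and ident_right: "f \<in> Hom C X Y \<Longrightarrow> f \<cdot> ident C X = f"
    and comp_assoc: "\<lbrakk>f \<in> Hom C W X; g \<in> Hom C X Y; h \<in> Hom C Y Z\<rbrakk> \<Longrightarrow> (h \<cdot> g) \<cdot> f = h \<cdot> (g \<cdot> f)"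

definition monic :: "('o, 'm, 'z) category_data_scheme \<Rightarrow> 'm \<Rightarrow> bool" where
  "monic C f \<longleftrightarrow> f \<in> arrows C \<and>
    (\<forall>W \<in> objects C. \<forall>g \<in> Hom C W (src C f). \<forall>h \<in> Hom C W (src C f).
       f \<cdot>\<^bsub>C\<^esub> g = f \<cdot>\<^bsub>C\<^esub> h \<longrightarrow> g = h)"

definition epic :: "('o, 'm, 'z) category_data_scheme \<Rightarrow> 'm \<Rightarrow> bool" where
  "epic C f \<longleftrightarrow> f \<in> arrows C \<and>
    (\<forall>Z \<in> objects C. \<forall>g \<in> Hom C (tgt C f) Z. \<forall>h \<in> Hom C (tgt C f) Z.
       g \<cdot>\<^bsub>C\<^esub> f = h \<cdot>\<^bsub>C\<^esub> f \<longrightarrow> g = h)"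

definition iso_arr :: "('o, 'm, 'z) category_data_scheme \<Rightarrow> 'm \<Rightarrow> bool" where
  "iso_arr C f \<longleftrightarrow> f \<in> arrows C \<and>
    (\<exists>g \<in> Hom C (tgt C f) (src C f). g \<cdot>\<^bsub>C\<^esub> f = ident C (src C f) \<and> f \<cdot>\<^bsub>C\<^esub> g = ident C (tgt C f))"

definition zero_object :: "('o, 'm, 'z) category_data_scheme \<Rightarrow> 'o \<Rightarrow> bool" where
  "zero_object C Z \<longleftrightarrow> Z \<in> objects C \<and>
    (\<forall>X \<in> objects C. (\<exists>!f. f \<in> Hom C X Z) \<and> (\<exists>!f. f \<in> Hom C Z X))"

definition simple_object :: "('o, 'm, 'z) category_data_scheme \<Rightarrow> 'o \<Rightarrow> bool" where
  "simple_object C X \<longleftrightarrow> X \<in> objects C \<and> \<not> zero_object C X \<and>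
    (\<forall>i. monic C i \<and> tgt C i = X \<longrightarrow> zero_object C (src C i) \<or> iso_arr C i)"


section \<open>Linear and abelian categories\<close>

record ('k, 'o, 'm) linear_category_data = "('o, 'm) category_data" +
  zero_arr :: "'o \<Rightarrow> 'o \<Rightarrow> 'm"
  add_arr :: "'m \<Rightarrow> 'm \<Rightarrow> 'm"
  scale_arr :: "'k \<Rightarrow> 'm \<Rightarrow> 'm"

text \<open>
  The hom-set \<open>Hom C X Y\<close> as a module. The module record extends the ring record, hence carries a
  multiplication and a unit: they are ignored by the module axioms, and we fill them with
  composition and identity so that \<open>hom_module C X X\<close> is also the endomorphism ring of \<open>X\<close>.
\<close>

definition hom_module ::
    "('k, 'o, 'm, 'z) linear_category_data_scheme \<Rightarrow> 'o \<Rightarrow> 'o \<Rightarrow> ('k, 'm) module" where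
  "hom_module C X Y =
    \<lparr>carrier = Hom C X Y, mult = comp_arr C, one = ident C X,
     zero = zero_arr C X Y, add = add_arr C, smult = scale_arr C\<rparr>"

definition linear_map ::
    "('k, 'r) ring_scheme \<Rightarrow> ('k, 'a, 's) module_scheme \<Rightarrow> ('k, 'b, 't) module_scheme \<Rightarrow>
     ('a \<Rightarrow> 'b) \<Rightarrow> bool" where
  "linear_map K M N h \<longleftrightarrow>
    h \<in> carrier M \<rightarrow> carrier N \<and>
    (\<forall>x \<in> carrier M. \<forall>y \<in> carrier M. h (x \<oplus>\<^bsub>M\<^esub> y) = h x \<oplus>\<^bsub>N\<^esub> h y) \<and>
    (\<forall>c \<in> carrier K. \<forall>x \<in> carrier M. h (c \<odot>\<^bsub>M\<^esub> x) = c \<odot>\<^bsub>N\<^esub> h x)"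

locale linear_category = field K + category C
  for K :: "('k, 'r) ring_scheme" and C :: "('k, 'o, 'm, 'z) linear_category_data_scheme" +
  assumes hom_module:
      "\<lbrakk>X \<in> objects C; Y \<in> objects C\<rbrakk> \<Longrightarrow> module K (hom_module C X Y)"
    and comp_linear_right:
      "\<lbrakk>X \<in> objects C; g \<in> Hom C Y Z\<rbrakk> \<Longrightarrow>
        linear_map K (hom_module C X Y) (hom_module C X Z) (\<lambda>f. g \<cdot>\<^bsub>C\<^esub> f)"
    and comp_linear_left:
      "\<lbrakk>Z \<in> objects C; f \<in> Hom C X Y\<rbrakk> \<Longrightarrow>
        linear_map K (hom_module C Y Z) (hom_module C X Z) (\<lambda>g. g \<cdot>\<^bsub>C\<^esub> f)"

definition is_kernel :: "('k, 'o, 'm, 'z) linear_category_data_scheme \<Rightarrow> 'm \<Rightarrow> 'm \<Rightarrow> bool" where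
  "is_kernel C f i \<longleftrightarrow> f \<in> arrows C \<and> i \<in> arrows C \<and> tgt C i = src C f \<and>
    f \<cdot>\<^bsub>C\<^esub> i = zero_arr C (src C i) (tgt C f) \<and>
    (\<forall>W \<in> objects C. \<forall>h \<in> Hom C W (src C f). f \<cdot>\<^bsub>C\<^esub> h = zero_arr C W (tgt C f) \<longrightarrow>
       (\<exists>!u. u \<in> Hom C W (src C i) \<and> i \<cdot>\<^bsub>C\<^esub> u = h))"

definition is_cokernel :: "('k, 'o, 'm, 'z) linear_category_data_scheme \<Rightarrow> 'm \<Rightarrow> 'm \<Rightarrow> bool" where
  "is_cokernel C f p \<longleftrightarrow> f \<in> arrows C \<and> p \<in> arrows C \<and> src C p = tgt C f \<and>
    p \<cdot>\<^bsub>C\<^esub> f = zero_arr C (src C f) (tgt C p) \<and>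
    (\<forall>Z \<in> objects C. \<forall>h \<in> Hom C (tgt C f) Z. h \<cdot>\<^bsub>C\<^esub> f = zero_arr C (src C f) Z \<longrightarrow>
       (\<exists>!u. u \<in> Hom C (tgt C p) Z \<and> u \<cdot>\<^bsub>C\<^esub> p = h))"

definition is_biproduct ::
    "('k, 'o, 'm, 'z) linear_category_data_scheme \<Rightarrow> 'o \<Rightarrow> 'o \<Rightarrow> 'o \<Rightarrow> 'm \<Rightarrow> 'm \<Rightarrow> 'm \<Rightarrow> 'm \<Rightarrow> bool" where
  "is_biproduct C X Y S i1 i2 p1 p2 \<longleftrightarrow> S \<in> objects C \<and>
    i1 \<in> Hom C X S \<and> i2 \<in> Hom C Y S \<and> p1 \<in> Hom C S X \<and> p2 \<in> Hom C S Y \<and>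
    p1 \<cdot>\<^bsub>C\<^esub> i1 = ident C X \<and> p2 \<cdot>\<^bsub>C\<^esub> i2 = ident C Y \<and>
    p2 \<cdot>\<^bsub>C\<^esub> i1 = zero_arr C X Y \<and> p1 \<cdot>\<^bsub>C\<^esub> i2 = zero_arr C Y X \<and>
    add_arr C (i1 \<cdot>\<^bsub>C\<^esub> p1) (i2 \<cdot>\<^bsub>C\<^esub> p2) = ident C S"

locale abelian_category = linear_category K C
  for K :: "('k, 'r) ring_scheme" and C :: "('k, 'o, 'm, 'z) linear_category_data_scheme" +
  assumes has_zero_object: "\<exists>Z. zero_object C Z"
    and has_biproducts:
      "\<lbrakk>X \<in> objects C; Y \<in> objects C\<rbrakk> \<Longrightarrow> \<exists>S i1 i2 p1 p2. is_biproduct C X Y S i1 i2 p1 p2"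
    and has_kernels: "f \<in> arrows C \<Longrightarrow> \<exists>i. is_kernel C f i"
    and has_cokernels: "f \<in> arrows C \<Longrightarrow> \<exists>p. is_cokernel C f p"
    and monic_is_kernel: "monic C i \<Longrightarrow> \<exists>f. is_kernel C f i"
    and epic_is_cokernel: "epic C p \<Longrightarrow> \<exists>f. is_cokernel C f p"

definition short_exact :: "('k, 'o, 'm, 'z) linear_category_data_scheme \<Rightarrow> 'm \<Rightarrow> 'm \<Rightarrow> bool" where
  "short_exact C i p \<longleftrightarrow> is_kernel C p i \<and> is_cokernel C i p"


section \<open>Strict rigid monoidal categories and tensor categories\<close>

text \<open>
  \<open>ldual X\<close> is the dual written \<open>X\<^sup>\<or>\<close> in the literature, with \<open>ev X : X\<^sup>\<or> \<otimes> X \<rightarrow> 1\<close>, and \<open>rdual X\<close> is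
  the dual written with the superscript on the left, with \<open>ev' X : X \<otimes> rdual X \<rightarrow> 1\<close>. The duals are
  chosen, as part of the structure.
\<close>

record ('k, 'o, 'm) tensor_category_data = "('k, 'o, 'm) linear_category_data" +
  tensor_obj :: "'o \<Rightarrow> 'o \<Rightarrow> 'o"  (infixl \<open>\<otimes>\<^sub>o\<index>\<close> 70)
  tensor_arr :: "'m \<Rightarrow> 'm \<Rightarrow> 'm"  (infixl \<open>\<otimes>\<^sub>a\<index>\<close> 70)
  unit_obj :: "'o"
  ldual :: "'o \<Rightarrow> 'o"
  ev :: "'o \<Rightarrow> 'm"
  coev :: "'o \<Rightarrow> 'm"
  rdual :: "'o \<Rightarrow> 'o"
  ev' :: "'o \<Rightarrow> 'm"
  coev' :: "'o \<Rightarrow> 'm"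

locale strict_monoidal_category = category C
  for C :: "('k, 'o, 'm, 'z) tensor_category_data_scheme" (structure) +
  assumes unit_closed: "unit_obj C \<in> objects C"
    and tensor_obj_closed: "\<lbrakk>X \<in> objects C; Y \<in> objects C\<rbrakk> \<Longrightarrow> X \<otimes>\<^sub>o Y \<in> objects C"
    and tensor_arr_closed:
      "\<lbrakk>f \<in> Hom C X X'; g \<in> Hom C Y Y'\<rbrakk> \<Longrightarrow> f \<otimes>\<^sub>a g \<in> Hom C (X \<otimes>\<^sub>o Y) (X' \<otimes>\<^sub>o Y')"
    and tensor_ident:
      "\<lbrakk>X \<in> objects C; Y \<in> objects C\<rbrakk> \<Longrightarrow> ident C X \<otimes>\<^sub>a ident C Y = ident C (X \<otimes>\<^sub>o Y)"
    and tensor_comp: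
      "\<lbrakk>f \<in> Hom C X X'; f' \<in> Hom C X' X''; g \<in> Hom C Y Y'; g' \<in> Hom C Y' Y''\<rbrakk> \<Longrightarrow>
        (f' \<cdot> f) \<otimes>\<^sub>a (g' \<cdot> g) = (f' \<otimes>\<^sub>a g') \<cdot> (f \<otimes>\<^sub>a g)"
    and tensor_obj_assoc:
      "\<lbrakk>X \<in> objects C; Y \<in> objects C; Z \<in> objects C\<rbrakk> \<Longrightarrow> (X \<otimes>\<^sub>o Y) \<otimes>\<^sub>o Z = X \<otimes>\<^sub>o (Y \<otimes>\<^sub>o Z)"
    and tensor_arr_assoc:
      "\<lbrakk>f \<in> arrows C; g \<in> arrows C; h \<in> arrows C\<rbrakk> \<Longrightarrow> (f \<otimes>\<^sub>a g) \<otimes>\<^sub>a h = f \<otimes>\<^sub>a (g \<otimes>\<^sub>a h)"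
    and unit_obj_left: "X \<in> objects C \<Longrightarrow> unit_obj C \<otimes>\<^sub>o X = X"
    and unit_obj_right: "X \<in> objects C \<Longrightarrow> X \<otimes>\<^sub>o unit_obj C = X"
    and unit_arr_left: "f \<in> arrows C \<Longrightarrow> ident C (unit_obj C) \<otimes>\<^sub>a f = f"
    and unit_arr_right: "f \<in> arrows C \<Longrightarrow> f \<otimes>\<^sub>a ident C (unit_obj C) = f"

locale rigid_monoidal_category = strict_monoidal_category C
  for C :: "('k, 'o, 'm, 'z) tensor_category_data_scheme" (structure) +
  assumes ldual_closed: "X \<in> objects C \<Longrightarrow> ldual C X \<in> objects C"
    and ev_closed: "X \<in> objects C \<Longrightarrow> ev C X \<in> Hom C (ldual C X \<otimes>\<^sub>o X) (unit_obj C)"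
    and coev_closed: "X \<in> objects C \<Longrightarrow> coev C X \<in> Hom C (unit_obj C) (X \<otimes>\<^sub>o ldual C X)"
    and zigzag_obj:
      "X \<in> objects C \<Longrightarrow> (ident C X \<otimes>\<^sub>a ev C X) \<cdot> (coev C X \<otimes>\<^sub>a ident C X) = ident C X"
    and zigzag_ldual:
      "X \<in> objects C \<Longrightarrow>
        (ev C X \<otimes>\<^sub>a ident C (ldual C X)) \<cdot> (ident C (ldual C X) \<otimes>\<^sub>a coev C X) = ident C (ldual C X)"
    and rdual_closed: "X \<in> objects C \<Longrightarrow> rdual C X \<in> objects C"
    and ev'_closed: "X \<in> objects C \<Longrightarrow> ev' C X \<in> Hom C (X \<otimes>\<^sub>o rdual C X) (unit_obj C)"
    and coev'_closed: "X \<in> objects C \<Longrightarrow> coev' C X \<in> Hom C (unit_obj C) (rdual C X \<otimes>\<^sub>o X)"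
    and zigzag'_obj:
      "X \<in> objects C \<Longrightarrow> (ev' C X \<otimes>\<^sub>a ident C X) \<cdot> (ident C X \<otimes>\<^sub>a coev' C X) = ident C X"
    and zigzag_rdual:
      "X \<in> objects C \<Longrightarrow>
        (ident C (rdual C X) \<otimes>\<^sub>a ev' C X) \<cdot> (coev' C X \<otimes>\<^sub>a ident C (rdual C X)) = ident C (rdual C X)"

text \<open>In \<open>End_unit\<close>, the isomorphism with the ground field is one of \<open>K\<close>-algebras.\<close>

locale tensor_category = abelian_category K C + rigid_monoidal_category C
  for K :: "('k, 'r) ring_scheme" and C :: "('k, 'o, 'm, 'z) tensor_category_data_scheme" +
  assumes tensor_linear_right:
      "\<lbrakk>f \<in> Hom C X X'; Y \<in> objects C; Y' \<in> objects C\<rbrakk> \<Longrightarrow>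
        linear_map K (hom_module C Y Y') (hom_module C (X \<otimes>\<^sub>o\<^bsub>C\<^esub> Y) (X' \<otimes>\<^sub>o\<^bsub>C\<^esub> Y')) (\<lambda>g. f \<otimes>\<^sub>a\<^bsub>C\<^esub> g)"
    and tensor_linear_left:
      "\<lbrakk>g \<in> Hom C Y Y'; X \<in> objects C; X' \<in> objects C\<rbrakk> \<Longrightarrow>
        linear_map K (hom_module C X X') (hom_module C (X \<otimes>\<^sub>o\<^bsub>C\<^esub> Y) (X' \<otimes>\<^sub>o\<^bsub>C\<^esub> Y')) (\<lambda>f. f \<otimes>\<^sub>a\<^bsub>C\<^esub> g)"
    and unit_simple: "simple_object C (unit_obj C)"
    and End_unit:
      "\<exists>\<phi> \<in> ring_iso K (hom_module C (unit_obj C) (unit_obj C)).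
        \<forall>a \<in> carrier K. \<forall>b \<in> carrier K. \<phi> (a \<otimes>\<^bsub>K\<^esub> b) = scale_arr C a (\<phi> b)"


section \<open>Functors\<close>

record ('o, 'm, 'p, 'n) functor_data =
  obj_map :: "'o \<Rightarrow> 'p"
  arr_map :: "'m \<Rightarrow> 'n"

locale category_functor = A: category A + B: category B
  for A :: "('o, 'm, 'a) category_data_scheme"
    and B :: "('p, 'n, 'b) category_data_scheme"
    and F :: "('o, 'm, 'p, 'n, 'f) functor_data_scheme" +
  assumes obj_map_closed: "X \<in> objects A \<Longrightarrow> obj_map F X \<in> objects B"
    and arr_map_closed: "f \<in> Hom A X Y \<Longrightarrow> arr_map F f \<in> Hom B (obj_map F X) (obj_map F Y)"
    and map_ident: "X \<in> objects A \<Longrightarrow> arr_map F (ident A X) = ident B (obj_map F X)"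
    and map_comp:
      "\<lbrakk>f \<in> Hom A X Y; g \<in> Hom A Y Z\<rbrakk> \<Longrightarrow> arr_map F (g \<cdot>\<^bsub>A\<^esub> f) = arr_map F g \<cdot>\<^bsub>B\<^esub> arr_map F f"

definition faithful_functor ::
    "('o, 'm, 'a) category_data_scheme \<Rightarrow> ('o, 'm, 'p, 'n, 'f) functor_data_scheme \<Rightarrow> bool" where
  "faithful_functor A F \<longleftrightarrow>
    (\<forall>X \<in> objects A. \<forall>Y \<in> objects A. inj_on (arr_map F) (Hom A X Y))"

definition linear_functor ::
    "('k, 'r) ring_scheme \<Rightarrow> ('k, 'o, 'm, 'a) linear_category_data_scheme \<Rightarrow>
     ('k, 'p, 'n, 'b) linear_category_data_scheme \<Rightarrow> ('o, 'm, 'p, 'n, 'f) functor_data_scheme \<Rightarrow> bool" where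
  "linear_functor K A B F \<longleftrightarrow>
    (\<forall>X \<in> objects A. \<forall>Y \<in> objects A.
       linear_map K (hom_module A X Y) (hom_module B (obj_map F X) (obj_map F Y)) (arr_map F))"

definition exact_functor ::
    "('k, 'o, 'm, 'a) linear_category_data_scheme \<Rightarrow> ('k, 'p, 'n, 'b) linear_category_data_scheme \<Rightarrow>
     ('o, 'm, 'p, 'n, 'f) functor_data_scheme \<Rightarrow> bool" where
  "exact_functor A B F \<longleftrightarrow>
    (\<forall>i p. short_exact A i p \<longrightarrow> short_exact B (arr_map F i) (arr_map F p))"

text \<open>
  A left adjoint of \<open>U : A \<rightarrow> B\<close> is a functor \<open>F : B \<rightarrow> A\<close> with bijections
  \<open>\<phi> X Y : Hom A (F X) Y \<rightarrow> Hom B X (U Y)\<close> natural in \<open>X\<close> and \<open>Y\<close>.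
\<close>

definition has_left_adjoint ::
    "('o, 'm, 'a) category_data_scheme \<Rightarrow> ('p, 'n, 'b) category_data_scheme \<Rightarrow>
     ('o, 'm, 'p, 'n, 'f) functor_data_scheme \<Rightarrow> bool" where
  "has_left_adjoint A B U \<longleftrightarrow>
    (\<exists>(F :: ('p, 'n, 'o, 'm) functor_data) \<phi>. category_functor B A F \<and>
      (\<forall>X \<in> objects B. \<forall>Y \<in> objects A.
         bij_betw (\<phi> X Y) (Hom A (obj_map F X) Y) (Hom B X (obj_map U Y))) \<and>
      (\<forall>X \<in> objects B. \<forall>X' \<in> objects B. \<forall>Y \<in> objects A. \<forall>Y' \<in> objects A.
         \<forall>h \<in> Hom B X' X. \<forall>f \<in> Hom A (obj_map F X) Y. \<forall>g \<in> Hom A Y Y'.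
           \<phi> X' Y' (g \<cdot>\<^bsub>A\<^esub> f \<cdot>\<^bsub>A\<^esub> arr_map F h) = arr_map U g \<cdot>\<^bsub>B\<^esub> \<phi> X Y f \<cdot>\<^bsub>B\<^esub> h))"

text \<open>
  Monoidal functors are strong (not necessarily strict): the structure arrows
  \<open>mu X Y : U X \<otimes> U Y \<rightarrow> U (X \<otimes> Y)\<close> and \<open>eta : 1 \<rightarrow> U 1\<close> are isomorphisms.
\<close>

record ('o, 'm, 'p, 'n) monoidal_functor_data = "('o, 'm, 'p, 'n) functor_data" +
  mu :: "'o \<Rightarrow> 'o \<Rightarrow> 'n"
  eta :: "'n"

locale monoidal_functor =
  A: strict_monoidal_category A + B: strict_monoidal_category B + category_functor A B U
  for A :: "('k, 'o, 'm, 'a) tensor_category_data_scheme"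
    and B :: "('l, 'p, 'n, 'b) tensor_category_data_scheme"
    and U :: "('o, 'm, 'p, 'n, 'f) monoidal_functor_data_scheme" +
  assumes mu_closed:
      "\<lbrakk>X \<in> objects A; Y \<in> objects A\<rbrakk> \<Longrightarrow>
        mu U X Y \<in> Hom B (obj_map U X \<otimes>\<^sub>o\<^bsub>B\<^esub> obj_map U Y) (obj_map U (X \<otimes>\<^sub>o\<^bsub>A\<^esub> Y))"
    and mu_iso: "\<lbrakk>X \<in> objects A; Y \<in> objects A\<rbrakk> \<Longrightarrow> iso_arr B (mu U X Y)"
    and mu_natural:
      "\<lbrakk>f \<in> Hom A X X'; g \<in> Hom A Y Y'\<rbrakk> \<Longrightarrow>
        mu U X' Y' \<cdot>\<^bsub>B\<^esub> (arr_map U f \<otimes>\<^sub>a\<^bsub>B\<^esub> arr_map U g) = arr_map U (f \<otimes>\<^sub>a\<^bsub>A\<^esub> g) \<cdot>\<^bsub>B\<^esub> mu U X Y"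
    and mu_assoc:
      "\<lbrakk>X \<in> objects A; Y \<in> objects A; Z \<in> objects A\<rbrakk> \<Longrightarrow>
        mu U (X \<otimes>\<^sub>o\<^bsub>A\<^esub> Y) Z \<cdot>\<^bsub>B\<^esub> (mu U X Y \<otimes>\<^sub>a\<^bsub>B\<^esub> ident B (obj_map U Z)) =
        mu U X (Y \<otimes>\<^sub>o\<^bsub>A\<^esub> Z) \<cdot>\<^bsub>B\<^esub> (ident B (obj_map U X) \<otimes>\<^sub>a\<^bsub>B\<^esub> mu U Y Z)"
    and eta_closed: "eta U \<in> Hom B (unit_obj B) (obj_map U (unit_obj A))"
    and eta_iso: "iso_arr B (eta U)"
    and eta_left:
      "X \<in> objects A \<Longrightarrow>
        mu U (unit_obj A) X \<cdot>\<^bsub>B\<^esub> (eta U \<otimes>\<^sub>a\<^bsub>B\<^esub> ident B (obj_map U X)) = ident B (obj_map U X)"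
    and eta_right:
      "X \<in> objects A \<Longrightarrow>
        mu U X (unit_obj A) \<cdot>\<^bsub>B\<^esub> (ident B (obj_map U X) \<otimes>\<^sub>a\<^bsub>B\<^esub> eta U) = ident B (obj_map U X)"


section \<open>Relatively projective objects\<close>

definition allowable ::
    "('o, 'm, 'a) category_data_scheme \<Rightarrow> ('p, 'n, 'b) category_data_scheme \<Rightarrow>
     ('o, 'm, 'p, 'n, 'f) functor_data_scheme \<Rightarrow> 'm \<Rightarrow> bool" where
  "allowable A B U f \<longleftrightarrow> f \<in> arrows A \<and>
    (\<exists>s \<in> Hom B (obj_map U (tgt A f)) (obj_map U (src A f)).
       arr_map U f \<cdot>\<^bsub>B\<^esub> s \<cdot>\<^bsub>B\<^esub> arr_map U f = arr_map U f)"

definition relatively_projective ::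
    "('o, 'm, 'a) category_data_scheme \<Rightarrow> ('p, 'n, 'b) category_data_scheme \<Rightarrow>
     ('o, 'm, 'p, 'n, 'f) functor_data_scheme \<Rightarrow> 'o \<Rightarrow> bool" where
  "relatively_projective A B U P \<longleftrightarrow> P \<in> objects A \<and>
    (\<forall>X \<in> objects A. \<forall>Y \<in> objects A. \<forall>f \<in> Hom A X Y. allowable A B U f \<and> epic A f \<longrightarrow>
       (\<forall>g \<in> Hom A P Y. \<exists>h \<in> Hom A P X. f \<cdot>\<^bsub>A\<^esub> h = g))"

text \<open>A full subcategory is determined by, and represented as, its set of objects.\<close>

definition Proj ::
    "('o, 'm, 'a) category_data_scheme \<Rightarrow> ('p, 'n, 'b) category_data_scheme \<Rightarrow>
     ('o, 'm, 'p, 'n, 'f) functor_data_scheme \<Rightarrow> 'o set" where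
  "Proj A B U = {P. relatively_projective A B U P}"

definition tensor_ideal :: "('k, 'o, 'm, 'a) tensor_category_data_scheme \<Rightarrow> 'o set \<Rightarrow> bool" where
  "tensor_ideal A S \<longleftrightarrow> S \<subseteq> objects A \<and>
    (\<forall>P \<in> S. \<forall>V \<in> objects A. P \<otimes>\<^sub>o\<^bsub>A\<^esub> V \<in> S \<and> V \<otimes>\<^sub>o\<^bsub>A\<^esub> P \<in> S)"

end

theory Submission
  imports Defs
begin

text \<open>
  Suppose \<open>D\<close> is a dual of \<open>V\<close>. Tensoring with \<open>V\<close> is left adjoint to tensoring with \<open>D\<close>, so
  lifting \<open>P \<otimes> V \<rightarrow> Y\<close> along an allowable epimorphism \<open>f : X \<rightarrow> Y\<close> amounts to lifting the transpose
  \<open>P \<rightarrow> Y \<otimes> D\<close> along \<open>f \<otimes> D\<close>. If \<open>P\<close> is relatively projective this is possible, because \<open>f \<otimes> D\<close>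
  is again an allowable epimorphism: a splitting of \<open>U f\<close> tensored with \<open>U D\<close> and conjugated by
  the structure isomorphisms of \<open>U\<close> splits \<open>U (f \<otimes> D)\<close> (\<open>allowable_tensor\<close>), and \<open>f \<otimes> D\<close> is epic
  because tensoring with \<open>D\<close> is itself a left adjoint, \<open>D\<close> having a dual too (\<open>epic_tensor\<close>). So
  \<open>P \<otimes> V\<close> is relatively projective, and \<open>V \<otimes> P\<close> is by the same argument for the reversed tensor
  product.

  Stability under duals is a consequence. The zigzag identity of \<open>D\<close> exhibits it as a retract of
  \<open>D \<otimes> V \<otimes> D\<close>, which lies in every tensor ideal containing \<open>V\<close>; and retracts of relatively
  projective objects are relatively projective.
\<close>

section \<open>Dual pairs and transposition\<close>

text \<open>
  Duals as a property, not as chosen structure: both kinds of chosen duals are instances, with \<open>X\<close>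
  paired with \<open>ldual X\<close>, and \<open>rdual X\<close> paired with \<open>X\<close>.
\<close>

definition dual_pair ::
    "('k, 'o, 'm, 'z) tensor_category_data_scheme \<Rightarrow> 'o \<Rightarrow> 'o \<Rightarrow> 'm \<Rightarrow> 'm \<Rightarrow> bool" where
  "dual_pair C V D e c \<longleftrightarrow> V \<in> objects C \<and> D \<in> objects C \<and>
    e \<in> Hom C (D \<otimes>\<^sub>o\<^bsub>C\<^esub> V) (unit_obj C) \<and> c \<in> Hom C (unit_obj C) (V \<otimes>\<^sub>o\<^bsub>C\<^esub> D) \<and>
    (ident C V \<otimes>\<^sub>a\<^bsub>C\<^esub> e) \<cdot>\<^bsub>C\<^esub> (c \<otimes>\<^sub>a\<^bsub>C\<^esub> ident C V) = ident C V \<and>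
    (e \<otimes>\<^sub>a\<^bsub>C\<^esub> ident C D) \<cdot>\<^bsub>C\<^esub> (ident C D \<otimes>\<^sub>a\<^bsub>C\<^esub> c) = ident C D"

lemma (in rigid_monoidal_category) dual_pair_ldual:
  "X \<in> objects C \<Longrightarrow> dual_pair C X (ldual C X) (ev C X) (coev C X)"
  unfolding dual_pair_def
  by (simp add: ldual_closed ev_closed coev_closed zigzag_obj zigzag_ldual)

lemma (in rigid_monoidal_category) dual_pair_rdual:
  "X \<in> objects C \<Longrightarrow> dual_pair C (rdual C X) X (ev' C X) (coev' C X)"
  unfolding dual_pair_def
  by (simp add: rdual_closed ev'_closed coev'_closed zigzag'_obj zigzag_rdual)

lemma (in category) Hom_objects:
  assumes "f \<in> Hom C X Y"
  shows "X \<in> objects C" "Y \<in> objects C"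
  using assms src_closed tgt_closed unfolding Hom_def by auto

lemma Hom_arrow: "f \<in> Hom C X Y \<Longrightarrow> f \<in> arrows C"
  by (simp add: Hom_def)

context strict_monoidal_category
begin

lemma tensor_comp_ident_right:
  assumes "f \<in> Hom C X Y" "g \<in> Hom C Y Z" "W \<in> objects C"
  shows "(g \<cdot> f) \<otimes>\<^sub>a ident C W = (g \<otimes>\<^sub>a ident C W) \<cdot> (f \<otimes>\<^sub>a ident C W)"
  using tensor_comp[OF assms(1,2) ident_closed[OF assms(3)] ident_closed[OF assms(3)]]
  by (simp add: ident_left[OF ident_closed[OF assms(3)]])

lemma tensor_comp_ident_left:
  assumes "f \<in> Hom C X Y" "g \<in> Hom C Y Z" "W \<in> objects C"
  shows "ident C W \<otimes>\<^sub>a (g \<cdot> f) = (ident C W \<otimes>\<^sub>a g) \<cdot> (ident C W \<otimes>\<^sub>a f)"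
  using tensor_comp[OF ident_closed[OF assms(3)] ident_closed[OF assms(3)] assms(1,2)]
  by (simp add: ident_left[OF ident_closed[OF assms(3)]])

lemma tensor_interchange:
  assumes f: "f \<in> Hom C X X'" and g: "g \<in> Hom C Y Y'"
  shows "(f \<otimes>\<^sub>a ident C Y') \<cdot> (ident C X \<otimes>\<^sub>a g) = (ident C X' \<otimes>\<^sub>a g) \<cdot> (f \<otimes>\<^sub>a ident C Y)"
proof -
  note idX = ident_closed[OF Hom_objects(1)[OF f]] and idX' = ident_closed[OF Hom_objects(2)[OF f]]
    and idY = ident_closed[OF Hom_objects(1)[OF g]] and idY' = ident_closed[OF Hom_objects(2)[OF g]]
  have "(f \<otimes>\<^sub>a ident C Y') \<cdot> (ident C X \<otimes>\<^sub>a g) = (f \<cdot> ident C X) \<otimes>\<^sub>a (ident C Y' \<cdot> g)"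
    by (rule tensor_comp[symmetric, OF idX f g idY'])
  also have "\<dots> = (ident C X' \<cdot> f) \<otimes>\<^sub>a (g \<cdot> ident C Y)"
    by (simp add: ident_left[OF f] ident_left[OF g] ident_right[OF f] ident_right[OF g])
  also have "\<dots> = (ident C X' \<otimes>\<^sub>a g) \<cdot> (f \<otimes>\<^sub>a ident C Y)"
    by (rule tensor_comp[OF f idX' idY g])
  finally show ?thesis .
qed

text \<open>
  The two directions \<open>Hom (P \<otimes> V) Y \<rightleftharpoons> Hom P (Y \<otimes> D)\<close> of the adjunction given by a dual pair with
  evaluation \<open>e\<close> and coevaluation \<open>c\<close>.
\<close>

definition transpose :: "'m \<Rightarrow> 'o \<Rightarrow> 'o \<Rightarrow> 'm \<Rightarrow> 'm" where
  "transpose c D P g = (g \<otimes>\<^sub>a ident C D) \<cdot> (ident C P \<otimes>\<^sub>a c)"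

definition untranspose :: "'m \<Rightarrow> 'o \<Rightarrow> 'o \<Rightarrow> 'm \<Rightarrow> 'm" where
  "untranspose e V Y h = (ident C Y \<otimes>\<^sub>a e) \<cdot> (h \<otimes>\<^sub>a ident C V)"

lemma ident_tensor_coev_closed:
  assumes "dual_pair C V D e c" and P: "P \<in> objects C"
  shows "ident C P \<otimes>\<^sub>a c \<in> Hom C P ((P \<otimes>\<^sub>o V) \<otimes>\<^sub>o D)"
  using assms tensor_arr_closed[OF ident_closed[OF P], of c "unit_obj C" "V \<otimes>\<^sub>o D"]
  by (simp add: dual_pair_def unit_obj_right tensor_obj_assoc)

lemma ident_tensor_ev_closed:
  assumes "dual_pair C V D e c" and Y: "Y \<in> objects C"
  shows "ident C Y \<otimes>\<^sub>a e \<in> Hom C ((Y \<otimes>\<^sub>o D) \<otimes>\<^sub>o V) Y"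
  using assms tensor_arr_closed[OF ident_closed[OF Y], of e "D \<otimes>\<^sub>o V" "unit_obj C"]
  by (simp add: dual_pair_def unit_obj_right tensor_obj_assoc)

lemma transpose_closed:
  assumes d: "dual_pair C V D e c" and P: "P \<in> objects C" and g: "g \<in> Hom C (P \<otimes>\<^sub>o V) Y"
  shows "transpose c D P g \<in> Hom C P (Y \<otimes>\<^sub>o D)"
proof -
  have "D \<in> objects C" using d by (simp add: dual_pair_def)
  then show ?thesis
    unfolding transpose_def
    by (intro comp_closed[OF ident_tensor_coev_closed[OF d P]] tensor_arr_closed g ident_closed)
qed

lemma untranspose_closed:
  assumes d: "dual_pair C V D e c" and Y: "Y \<in> objects C" and h: "h \<in> Hom C P (Y \<otimes>\<^sub>o D)"
  shows "untranspose e V Y h \<in> Hom C (P \<otimes>\<^sub>o V) Y"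
proof -
  have "V \<in> objects C" using d by (simp add: dual_pair_def)
  then show ?thesis
    unfolding untranspose_def
    by (intro comp_closed[OF _ ident_tensor_ev_closed[OF d Y]] tensor_arr_closed h ident_closed)
qed

text \<open>
  Slide \<open>g\<close> past the evaluation; what remains in front of it is \<open>P\<close> tensored with the zigzag of \<open>V\<close>.
\<close>

lemma untranspose_transpose:
  assumes d: "dual_pair C V D e c" and P: "P \<in> objects C" and g: "g \<in> Hom C (P \<otimes>\<^sub>o V) Y"
  shows "untranspose e V Y (transpose c D P g) = g"
proof -
  from d have V: "V \<in> objects C" and D: "D \<in> objects C"
    and e: "e \<in> Hom C (D \<otimes>\<^sub>o V) (unit_obj C)" and c: "c \<in> Hom C (unit_obj C) (V \<otimes>\<^sub>o D)"
    and zz: "(ident C V \<otimes>\<^sub>a e) \<cdot> (c \<otimes>\<^sub>a ident C V) = ident C V"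
    by (auto simp: dual_pair_def)
  have Y: "Y \<in> objects C" using Hom_objects(2)[OF g] .
  have PV: "P \<otimes>\<^sub>o V \<in> objects C" and DV: "D \<otimes>\<^sub>o V \<in> objects C"
    using P V D by (auto intro: tensor_obj_closed)
  note idP = ident_closed[OF P] and idV = ident_closed[OF V] and idD = ident_closed[OF D]
    and idY = ident_closed[OF Y]
  note Pc = ident_tensor_coev_closed[OF d P]
  have gD: "g \<otimes>\<^sub>a ident C D \<in> Hom C ((P \<otimes>\<^sub>o V) \<otimes>\<^sub>o D) (Y \<otimes>\<^sub>o D)"
    by (rule tensor_arr_closed[OF g idD])
  have PcV: "(ident C P \<otimes>\<^sub>a c) \<otimes>\<^sub>a ident C V \<in> Hom C (P \<otimes>\<^sub>o V) (((P \<otimes>\<^sub>o V) \<otimes>\<^sub>o D) \<otimes>\<^sub>o V)"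
    by (rule tensor_arr_closed[OF Pc idV])
  have gDV: "(g \<otimes>\<^sub>a ident C D) \<otimes>\<^sub>a ident C V \<in> Hom C (((P \<otimes>\<^sub>o V) \<otimes>\<^sub>o D) \<otimes>\<^sub>o V) ((Y \<otimes>\<^sub>o D) \<otimes>\<^sub>o V)"
    by (rule tensor_arr_closed[OF gD idV])
  have gDV_eq: "(g \<otimes>\<^sub>a ident C D) \<otimes>\<^sub>a ident C V = g \<otimes>\<^sub>a ident C (D \<otimes>\<^sub>o V)"
    by (simp add: tensor_arr_assoc Hom_arrow[OF g] Hom_arrow[OF idD] Hom_arrow[OF idV]
        tensor_ident D V)
  have slide: "(ident C Y \<otimes>\<^sub>a e) \<cdot> ((g \<otimes>\<^sub>a ident C D) \<otimes>\<^sub>a ident C V) = g \<cdot> (ident C (P \<otimes>\<^sub>o V) \<otimes>\<^sub>a e)"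
    using tensor_interchange[OF g e] by (simp add: gDV_eq unit_arr_right Hom_arrow[OF g])
  have PVe: "ident C (P \<otimes>\<^sub>o V) \<otimes>\<^sub>a e = ident C P \<otimes>\<^sub>a (ident C V \<otimes>\<^sub>a e)"
    by (simp add: tensor_ident[OF P V, symmetric] tensor_arr_assoc Hom_arrow[OF idP]
        Hom_arrow[OF idV] Hom_arrow[OF e])
  have PcV_eq: "(ident C P \<otimes>\<^sub>a c) \<otimes>\<^sub>a ident C V = ident C P \<otimes>\<^sub>a (c \<otimes>\<^sub>a ident C V)"
    by (simp add: tensor_arr_assoc Hom_arrow[OF idP] Hom_arrow[OF idV] Hom_arrow[OF c])
  have cV: "c \<otimes>\<^sub>a ident C V \<in> Hom C V ((V \<otimes>\<^sub>o D) \<otimes>\<^sub>o V)"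
    using tensor_arr_closed[OF c idV] V by (simp add: unit_obj_left)
  have Ve: "ident C V \<otimes>\<^sub>a e \<in> Hom C ((V \<otimes>\<^sub>o D) \<otimes>\<^sub>o V) V"
    by (rule ident_tensor_ev_closed[OF d V])
  have zzP: "(ident C (P \<otimes>\<^sub>o V) \<otimes>\<^sub>a e) \<cdot> ((ident C P \<otimes>\<^sub>a c) \<otimes>\<^sub>a ident C V) = ident C (P \<otimes>\<^sub>o V)"
    unfolding PVe PcV_eq
    by (simp add: tensor_comp_ident_left[OF cV Ve P, symmetric] zz tensor_ident P V)
  have "untranspose e V Y (transpose c D P g) =
      (ident C Y \<otimes>\<^sub>a e) \<cdot> (((g \<otimes>\<^sub>a ident C D) \<otimes>\<^sub>a ident C V) \<cdot> ((ident C P \<otimes>\<^sub>a c) \<otimes>\<^sub>a ident C V))"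
    unfolding untranspose_def transpose_def by (simp add: tensor_comp_ident_right[OF Pc gD V])
  also have "\<dots> = ((ident C Y \<otimes>\<^sub>a e) \<cdot> ((g \<otimes>\<^sub>a ident C D) \<otimes>\<^sub>a ident C V)) \<cdot>
      ((ident C P \<otimes>\<^sub>a c) \<otimes>\<^sub>a ident C V)"
    by (rule comp_assoc[symmetric, OF PcV gDV ident_tensor_ev_closed[OF d Y]])
  also have "\<dots> = g \<cdot> ((ident C (P \<otimes>\<^sub>o V) \<otimes>\<^sub>a e) \<cdot> ((ident C P \<otimes>\<^sub>a c) \<otimes>\<^sub>a ident C V))"
    unfolding slide by (rule comp_assoc[OF PcV ident_tensor_ev_closed[OF d PV] g])
  also have "\<dots> = g"
    unfolding zzP by (rule ident_right[OF g])
  finally show ?thesis .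
qed

lemma transpose_natural:
  assumes d: "dual_pair C V D e c" and f: "f \<in> Hom C X P" and g: "g \<in> Hom C (P \<otimes>\<^sub>o V) Y"
  shows "transpose c D X (g \<cdot> (f \<otimes>\<^sub>a ident C V)) = transpose c D P g \<cdot> f"
proof -
  from d have V: "V \<in> objects C" and D: "D \<in> objects C"
    and c: "c \<in> Hom C (unit_obj C) (V \<otimes>\<^sub>o D)"
    by (auto simp: dual_pair_def)
  note X = Hom_objects(1)[OF f] and P = Hom_objects(2)[OF f]
  note Pc = ident_tensor_coev_closed[OF d P] and Xc = ident_tensor_coev_closed[OF d X]
  note idV = ident_closed[OF V] and idD = ident_closed[OF D]
  have fV: "f \<otimes>\<^sub>a ident C V \<in> Hom C (X \<otimes>\<^sub>o V) (P \<otimes>\<^sub>o V)"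
    by (rule tensor_arr_closed[OF f idV])
  note fVD = tensor_arr_closed[OF fV idD] and gD = tensor_arr_closed[OF g idD]
  have fVD_eq: "(f \<otimes>\<^sub>a ident C V) \<otimes>\<^sub>a ident C D = f \<otimes>\<^sub>a ident C (V \<otimes>\<^sub>o D)"
    by (simp add: tensor_arr_assoc Hom_arrow[OF f] Hom_arrow[OF idD] Hom_arrow[OF idV]
        tensor_ident D V)
  have slide: "((f \<otimes>\<^sub>a ident C V) \<otimes>\<^sub>a ident C D) \<cdot> (ident C X \<otimes>\<^sub>a c) = (ident C P \<otimes>\<^sub>a c) \<cdot> f"
    using tensor_interchange[OF f c] by (simp add: fVD_eq unit_arr_right Hom_arrow[OF f])
  have "transpose c D X (g \<cdot> (f \<otimes>\<^sub>a ident C V)) =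
      ((g \<otimes>\<^sub>a ident C D) \<cdot> ((f \<otimes>\<^sub>a ident C V) \<otimes>\<^sub>a ident C D)) \<cdot> (ident C X \<otimes>\<^sub>a c)"
    unfolding transpose_def by (simp add: tensor_comp_ident_right[OF fV g D])
  also have "\<dots> = (g \<otimes>\<^sub>a ident C D) \<cdot> ((ident C P \<otimes>\<^sub>a c) \<cdot> f)"
    by (simp add: comp_assoc[OF Xc fVD gD] slide)
  also have "\<dots> = transpose c D P g \<cdot> f"
    unfolding transpose_def by (rule comp_assoc[symmetric, OF f Pc gD])
  finally show ?thesis .
qed

lemma untranspose_natural:
  assumes d: "dual_pair C V D e c" and f: "f \<in> Hom C X Y" and h: "h \<in> Hom C P (X \<otimes>\<^sub>o D)"
  shows "untranspose e V Y ((f \<otimes>\<^sub>a ident C D) \<cdot> h) = f \<cdot> untranspose e V X h"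
proof -
  from d have V: "V \<in> objects C" and D: "D \<in> objects C"
    and e: "e \<in> Hom C (D \<otimes>\<^sub>o V) (unit_obj C)"
    by (auto simp: dual_pair_def)
  note X = Hom_objects(1)[OF f] and Y = Hom_objects(2)[OF f]
  note Xe = ident_tensor_ev_closed[OF d X] and Ye = ident_tensor_ev_closed[OF d Y]
  note idV = ident_closed[OF V] and idD = ident_closed[OF D]
  have fD: "f \<otimes>\<^sub>a ident C D \<in> Hom C (X \<otimes>\<^sub>o D) (Y \<otimes>\<^sub>o D)"
    by (rule tensor_arr_closed[OF f idD])
  note fDV = tensor_arr_closed[OF fD idV] and hV = tensor_arr_closed[OF h idV]
  have fDV_eq: "(f \<otimes>\<^sub>a ident C D) \<otimes>\<^sub>a ident C V = f \<otimes>\<^sub>a ident C (D \<otimes>\<^sub>o V)"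
    by (simp add: tensor_arr_assoc Hom_arrow[OF f] Hom_arrow[OF idD] Hom_arrow[OF idV]
        tensor_ident D V)
  have slide: "(ident C Y \<otimes>\<^sub>a e) \<cdot> ((f \<otimes>\<^sub>a ident C D) \<otimes>\<^sub>a ident C V) = f \<cdot> (ident C X \<otimes>\<^sub>a e)"
    using tensor_interchange[OF f e] by (simp add: fDV_eq unit_arr_right Hom_arrow[OF f])
  have "untranspose e V Y ((f \<otimes>\<^sub>a ident C D) \<cdot> h) =
      (ident C Y \<otimes>\<^sub>a e) \<cdot> (((f \<otimes>\<^sub>a ident C D) \<otimes>\<^sub>a ident C V) \<cdot> (h \<otimes>\<^sub>a ident C V))"
    unfolding untranspose_def by (simp add: tensor_comp_ident_right[OF h fD V])
  also have "\<dots> = (f \<cdot> (ident C X \<otimes>\<^sub>a e)) \<cdot> (h \<otimes>\<^sub>a ident C V)"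
    by (simp add: comp_assoc[OF hV fDV Ye, symmetric] slide)
  also have "\<dots> = f \<cdot> untranspose e V X h"
    unfolding untranspose_def by (rule comp_assoc[OF hV Xe f])
  finally show ?thesis .
qed

text \<open>
  Left adjoints preserve epimorphisms: two arrows that agree after \<open>f \<otimes> V\<close> have transposes that
  agree after \<open>f\<close>, and transposition is injective.
\<close>

lemma epic_tensor:
  assumes d: "dual_pair C V D e c" and f: "f \<in> Hom C X Y" and "epic C f"
  shows "epic C (f \<otimes>\<^sub>a ident C V)"
proof -
  from d have V: "V \<in> objects C" and D: "D \<in> objects C"
    by (auto simp: dual_pair_def)
  note Y = Hom_objects(2)[OF f]
  have fV: "f \<otimes>\<^sub>a ident C V \<in> Hom C (X \<otimes>\<^sub>o V) (Y \<otimes>\<^sub>o V)"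
    by (rule tensor_arr_closed[OF f ident_closed[OF V]])
  have "g = h"
    if Z: "Z \<in> objects C" and g: "g \<in> Hom C (Y \<otimes>\<^sub>o V) Z" and h: "h \<in> Hom C (Y \<otimes>\<^sub>o V) Z"
      and eq: "g \<cdot> (f \<otimes>\<^sub>a ident C V) = h \<cdot> (f \<otimes>\<^sub>a ident C V)" for Z g h
  proof -
    have "transpose c D Y g \<cdot> f = transpose c D Y h \<cdot> f"
      by (simp add: transpose_natural[OF d f g, symmetric] transpose_natural[OF d f h, symmetric] eq)
    moreover have "tgt C f = Y" using f by (simp add: Hom_def)
    ultimately have "transpose c D Y g = transpose c D Y h"
      using \<open>epic C f\<close> transpose_closed[OF d Y g] transpose_closed[OF d Y h]
        tensor_obj_closed[OF Z D]
      unfolding epic_def by blast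
    then show "g = h"
      using untranspose_transpose[OF d Y g] untranspose_transpose[OF d Y h] by metis
  qed
  moreover have "tgt C (f \<otimes>\<^sub>a ident C V) = Y \<otimes>\<^sub>o V" using fV by (simp add: Hom_def)
  ultimately show ?thesis
    using Hom_arrow[OF fV] unfolding epic_def by simp
qed

end

section \<open>Relatively projective objects\<close>

lemma (in category_functor) relatively_projective_retract:
  assumes Q: "relatively_projective A B F Q"
    and i: "i \<in> Hom A P Q" and r: "r \<in> Hom A Q P" and ri: "r \<cdot>\<^bsub>A\<^esub> i = ident A P"
  shows "relatively_projective A B F P"
  unfolding relatively_projective_def
proof (intro conjI ballI impI)
  show "P \<in> objects A" using A.Hom_objects(1)[OF i] .
  fix X Y f g
  assume "X \<in> objects A" "Y \<in> objects A" and f: "f \<in> Hom A X Y"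
    and ae: "allowable A B F f \<and> epic A f" and g: "g \<in> Hom A P Y"
  moreover have "g \<cdot>\<^bsub>A\<^esub> r \<in> Hom A Q Y" by (rule A.comp_closed[OF r g])
  ultimately obtain h where h: "h \<in> Hom A Q X" and fh: "f \<cdot>\<^bsub>A\<^esub> h = g \<cdot>\<^bsub>A\<^esub> r"
    using Q unfolding relatively_projective_def by meson
  have "f \<cdot>\<^bsub>A\<^esub> (h \<cdot>\<^bsub>A\<^esub> i) = (f \<cdot>\<^bsub>A\<^esub> h) \<cdot>\<^bsub>A\<^esub> i"
    by (rule A.comp_assoc[symmetric, OF i h f])
  also have "\<dots> = g"
    by (simp add: fh A.comp_assoc[OF i r g] ri A.ident_right[OF g])
  finally show "\<exists>h \<in> Hom A P X. f \<cdot>\<^bsub>A\<^esub> h = g"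
    using A.comp_closed[OF i h] by blast
qed

context monoidal_functor
begin

lemma allowable_tensor:
  assumes f: "f \<in> Hom A X Y" and "allowable A B U f" and D: "D \<in> objects A"
  shows "allowable A B U (f \<otimes>\<^sub>a\<^bsub>A\<^esub> ident A D)"
proof -
  note X = A.Hom_objects(1)[OF f] and Y = A.Hom_objects(2)[OF f]
  note UD = obj_map_closed[OF D]
  let ?UX = "obj_map U X" and ?UY = "obj_map U Y" and ?UD = "obj_map U D"
  let ?UXD = "obj_map U (X \<otimes>\<^sub>o\<^bsub>A\<^esub> D)" and ?UYD = "obj_map U (Y \<otimes>\<^sub>o\<^bsub>A\<^esub> D)"
  let ?i = "ident B ?UD" and ?Uf = "arr_map U f" and ?UfD = "arr_map U (f \<otimes>\<^sub>a\<^bsub>A\<^esub> ident A D)"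
  obtain s where s: "s \<in> Hom B ?UY ?UX" and fsf: "?Uf \<cdot>\<^bsub>B\<^esub> s \<cdot>\<^bsub>B\<^esub> ?Uf = ?Uf"
    using \<open>allowable A B U f\<close> f unfolding allowable_def Hom_def by auto
  have fD: "f \<otimes>\<^sub>a\<^bsub>A\<^esub> ident A D \<in> Hom A (X \<otimes>\<^sub>o\<^bsub>A\<^esub> D) (Y \<otimes>\<^sub>o\<^bsub>A\<^esub> D)"
    by (rule A.tensor_arr_closed[OF f A.ident_closed[OF D]])
  have Uf: "?Uf \<in> Hom B ?UX ?UY" and UfD: "?UfD \<in> Hom B ?UXD ?UYD"
    by (rule arr_map_closed[OF f], rule arr_map_closed[OF fD])
  note mX = mu_closed[OF X D] and mY = mu_closed[OF Y D]
  obtain nX where nX: "nX \<in> Hom B ?UXD (?UX \<otimes>\<^sub>o\<^bsub>B\<^esub> ?UD)"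
    and mnX: "mu U X D \<cdot>\<^bsub>B\<^esub> nX = ident B ?UXD"
    using mu_iso[OF X D] mX unfolding iso_arr_def Hom_def by auto
  obtain nY where nY: "nY \<in> Hom B ?UYD (?UY \<otimes>\<^sub>o\<^bsub>B\<^esub> ?UD)"
    and nmY: "nY \<cdot>\<^bsub>B\<^esub> mu U Y D = ident B (?UY \<otimes>\<^sub>o\<^bsub>B\<^esub> ?UD)"
    using mu_iso[OF Y D] mY unfolding iso_arr_def Hom_def by auto
  let ?F = "?Uf \<otimes>\<^sub>a\<^bsub>B\<^esub> ?i" and ?S = "s \<otimes>\<^sub>a\<^bsub>B\<^esub> ?i"
  note F = B.tensor_arr_closed[OF Uf B.ident_closed[OF UD]]
    and S = B.tensor_arr_closed[OF s B.ident_closed[OF UD]]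
  have FSF: "?F \<cdot>\<^bsub>B\<^esub> ?S \<cdot>\<^bsub>B\<^esub> ?F = ?F"
    using B.tensor_comp_ident_right[OF B.comp_closed[OF Uf s] Uf UD]
      B.tensor_comp_ident_right[OF Uf s UD] fsf by simp
  have nat: "mu U Y D \<cdot>\<^bsub>B\<^esub> ?F = ?UfD \<cdot>\<^bsub>B\<^esub> mu U X D"
    using mu_natural[OF f A.ident_closed[OF D]] by (simp add: map_ident[OF D])
  have UfD_eq: "?UfD = mu U Y D \<cdot>\<^bsub>B\<^esub> ?F \<cdot>\<^bsub>B\<^esub> nX"
  proof -
    have "?UfD = ?UfD \<cdot>\<^bsub>B\<^esub> mu U X D \<cdot>\<^bsub>B\<^esub> nX"
      by (simp add: mnX B.ident_right[OF UfD])
    also have "\<dots> = (mu U Y D \<cdot>\<^bsub>B\<^esub> ?F) \<cdot>\<^bsub>B\<^esub> nX"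
      by (simp add: nat B.comp_assoc[OF nX mX UfD])
    also have "\<dots> = mu U Y D \<cdot>\<^bsub>B\<^esub> ?F \<cdot>\<^bsub>B\<^esub> nX"
      by (rule B.comp_assoc[OF nX F mY])
    finally show ?thesis .
  qed
  \<comment> \<open>The splitting of \<open>U (f \<otimes> D)\<close>: \<open>s \<otimes> U D\<close> conjugated by \<open>mu\<close>.\<close>
  let ?t = "mu U X D \<cdot>\<^bsub>B\<^esub> ?S \<cdot>\<^bsub>B\<^esub> nY"
  note SnY = B.comp_closed[OF nY S] and FnX = B.comp_closed[OF nX F]
  have t: "?t \<in> Hom B ?UYD ?UXD" by (rule B.comp_closed[OF SnY mX])
  have tUfD: "?t \<cdot>\<^bsub>B\<^esub> ?UfD = mu U X D \<cdot>\<^bsub>B\<^esub> ?S \<cdot>\<^bsub>B\<^esub> ?F \<cdot>\<^bsub>B\<^esub> nX"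
  proof -
    have "nY \<cdot>\<^bsub>B\<^esub> ?UfD = ?F \<cdot>\<^bsub>B\<^esub> nX"
      unfolding UfD_eq
      by (simp add: B.comp_assoc[OF FnX mY nY, symmetric] nmY B.ident_left[OF FnX])
    then show ?thesis
      by (simp add: B.comp_assoc[OF UfD SnY mX] B.comp_assoc[OF UfD nY S])
  qed
  note SFnX = B.comp_closed[OF FnX S]
  have "?UfD \<cdot>\<^bsub>B\<^esub> ?t \<cdot>\<^bsub>B\<^esub> ?UfD = mu U Y D \<cdot>\<^bsub>B\<^esub> ?F \<cdot>\<^bsub>B\<^esub> ?S \<cdot>\<^bsub>B\<^esub> ?F \<cdot>\<^bsub>B\<^esub> nX"
    unfolding tUfD
    by (simp add: B.comp_assoc[OF SFnX mX UfD, symmetric] nat[symmetric]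
        B.comp_assoc[OF SFnX F mY])
  also have "\<dots> = mu U Y D \<cdot>\<^bsub>B\<^esub> (?F \<cdot>\<^bsub>B\<^esub> ?S \<cdot>\<^bsub>B\<^esub> ?F) \<cdot>\<^bsub>B\<^esub> nX"
    by (simp only: B.comp_assoc[OF nX F S] B.comp_assoc[OF nX B.comp_closed[OF F S] F])
  also have "\<dots> = ?UfD"
    by (simp only: FSF UfD_eq)
  finally have "?UfD \<cdot>\<^bsub>B\<^esub> ?t \<cdot>\<^bsub>B\<^esub> ?UfD = ?UfD" .
  then show ?thesis
    using t fD unfolding allowable_def Hom_def by auto
qed

text \<open>
  A left adjoint preserves relative projectivity if its right adjoint preserves allowable
  epimorphisms. The dual \<open>D'\<close> of \<open>D\<close> is what makes \<open>- \<otimes> D\<close> preserve epimorphisms.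
\<close>

lemma relatively_projective_tensor_right:
  assumes d: "dual_pair A V D e c" and d': "dual_pair A D D' e' c'"
    and P: "relatively_projective A B U P"
  shows "relatively_projective A B U (P \<otimes>\<^sub>o\<^bsub>A\<^esub> V)"
  unfolding relatively_projective_def
proof (intro conjI ballI impI)
  from d have V: "V \<in> objects A" and D: "D \<in> objects A"
    by (auto simp: dual_pair_def)
  have Pobj: "P \<in> objects A" using P by (simp add: relatively_projective_def)
  show "P \<otimes>\<^sub>o\<^bsub>A\<^esub> V \<in> objects A" by (rule A.tensor_obj_closed[OF Pobj V])
  fix X Y f g
  assume X: "X \<in> objects A" and Y: "Y \<in> objects A" and f: "f \<in> Hom A X Y"
    and ae: "allowable A B U f \<and> epic A f" and g: "g \<in> Hom A (P \<otimes>\<^sub>o\<^bsub>A\<^esub> V) Y"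
  have "f \<otimes>\<^sub>a\<^bsub>A\<^esub> ident A D \<in> Hom A (X \<otimes>\<^sub>o\<^bsub>A\<^esub> D) (Y \<otimes>\<^sub>o\<^bsub>A\<^esub> D)"
    by (rule A.tensor_arr_closed[OF f A.ident_closed[OF D]])
  moreover have "allowable A B U (f \<otimes>\<^sub>a\<^bsub>A\<^esub> ident A D) \<and> epic A (f \<otimes>\<^sub>a\<^bsub>A\<^esub> ident A D)"
    using ae allowable_tensor[OF f _ D] A.epic_tensor[OF d' f] by blast
  ultimately obtain h where h: "h \<in> Hom A P (X \<otimes>\<^sub>o\<^bsub>A\<^esub> D)"
    and eq: "(f \<otimes>\<^sub>a\<^bsub>A\<^esub> ident A D) \<cdot>\<^bsub>A\<^esub> h = A.transpose c D P g"
    using P A.transpose_closed[OF d Pobj g] A.tensor_obj_closed[OF X D] A.tensor_obj_closed[OF Y D]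
    unfolding relatively_projective_def by meson
  have "f \<cdot>\<^bsub>A\<^esub> A.untranspose e V X h = g"
    using A.untranspose_natural[OF d f h] A.untranspose_transpose[OF d Pobj g] eq by simp
  then show "\<exists>h \<in> Hom A (P \<otimes>\<^sub>o\<^bsub>A\<^esub> V) X. f \<cdot>\<^bsub>A\<^esub> h = g"
    using A.untranspose_closed[OF d X h] by blast
qed

end

section \<open>Reversing the tensor product\<close>

text \<open>
  Reversal preserves composition, hence relative projectivity, and exchanges the members of a dual
  pair. So multiplying by \<open>V\<close> on the left is dealt with by multiplying on the right in the reversed
  category, with \<open>V\<close> now paired to the dual on its other side.
\<close>

definition reverse ::
    "('k, 'o, 'm, 'z) tensor_category_data_scheme \<Rightarrow> ('k, 'o, 'm, 'z) tensor_category_data_scheme"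
  where
  "reverse C = C\<lparr>tensor_obj := \<lambda>X Y. Y \<otimes>\<^sub>o\<^bsub>C\<^esub> X, tensor_arr := \<lambda>f g. g \<otimes>\<^sub>a\<^bsub>C\<^esub> f\<rparr>"

definition reverse_functor ::
    "('o, 'm, 'p, 'n, 'f) monoidal_functor_data_scheme \<Rightarrow>
     ('o, 'm, 'p, 'n, 'f) monoidal_functor_data_scheme" where
  "reverse_functor U = U\<lparr>mu := \<lambda>X Y. mu U Y X\<rparr>"

lemma reverse_simps [simp]:
  "objects (reverse C) = objects C" "arrows (reverse C) = arrows C"
  "src (reverse C) = src C" "tgt (reverse C) = tgt C"
  "ident (reverse C) = ident C" "comp_arr (reverse C) = comp_arr C"
  "unit_obj (reverse C) = unit_obj C"
  "tensor_obj (reverse C) X Y = tensor_obj C Y X"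
  "tensor_arr (reverse C) f g = tensor_arr C g f"
  "Hom (reverse C) = Hom C"
  "epic (reverse C) = epic C" "iso_arr (reverse C) = iso_arr C"
  by (simp_all add: reverse_def Hom_def epic_def iso_arr_def fun_eq_iff)

lemma reverse_functor_simps [simp]:
  "obj_map (reverse_functor U) = obj_map U" "arr_map (reverse_functor U) = arr_map U"
  "mu (reverse_functor U) X Y = mu U Y X" "eta (reverse_functor U) = eta U"
  by (simp_all add: reverse_functor_def)

lemma category_reverse: "category C \<Longrightarrow> category (reverse C)"
  by (simp only: category_def reverse_simps)

lemma strict_monoidal_category_reverse:
  assumes "strict_monoidal_category C"
  shows "strict_monoidal_category (reverse C)"
proof -
  interpret strict_monoidal_category C by fact
  interpret R: category "reverse C" by (rule category_reverse) unfold_locales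
  show ?thesis
    by (unfold_locales; unfold reverse_simps)
      (rule unit_closed tensor_obj_closed tensor_arr_closed tensor_ident tensor_comp
        tensor_obj_assoc[symmetric] tensor_arr_assoc[symmetric] unit_obj_left unit_obj_right
        unit_arr_left unit_arr_right; assumption)+
qed

lemma monoidal_functor_reverse:
  assumes "monoidal_functor A B U"
  shows "monoidal_functor (reverse A) (reverse B) (reverse_functor U)"
proof -
  interpret monoidal_functor A B U by fact
  interpret RA: strict_monoidal_category "reverse A"
    by (rule strict_monoidal_category_reverse) unfold_locales
  interpret RB: strict_monoidal_category "reverse B"
    by (rule strict_monoidal_category_reverse) unfold_locales
  show ?thesis
    by (unfold_locales; unfold reverse_simps reverse_functor_simps)
      (rule obj_map_closed arr_map_closed map_ident map_comp mu_closed mu_iso mu_natural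
        mu_assoc[symmetric] eta_closed eta_iso eta_left eta_right; assumption)+
qed

lemma dual_pair_reverse: "dual_pair C V D e c \<Longrightarrow> dual_pair (reverse C) D V e c"
  by (simp add: dual_pair_def)

lemma relatively_projective_reverse:
  "relatively_projective (reverse A) (reverse B) (reverse_functor U) = relatively_projective A B U"
  by (simp add: relatively_projective_def allowable_def fun_eq_iff)

lemma (in monoidal_functor) relatively_projective_tensor_left:
  assumes d: "dual_pair A D V e c" and d': "dual_pair A D' D e' c'"
    and P: "relatively_projective A B U P"
  shows "relatively_projective A B U (V \<otimes>\<^sub>o\<^bsub>A\<^esub> P)"
proof -
  interpret R: monoidal_functor "reverse A" "reverse B" "reverse_functor U"
    by (rule monoidal_functor_reverse) unfold_locales
  show ?thesis
    using R.relatively_projective_tensor_right[OF dual_pair_reverse[OF d] dual_pair_reverse[OF d']] P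
    by (simp add: relatively_projective_reverse)
qed

section \<open>The ideal and its stability under duals\<close>

lemma tensor_ideal_Proj:
  assumes "rigid_monoidal_category A" and "monoidal_functor A B U"
  shows "tensor_ideal A (Proj A B U)"
proof -
  interpret rigid_monoidal_category A by fact
  interpret monoidal_functor A B U by fact
  have "P \<otimes>\<^sub>o\<^bsub>A\<^esub> V \<in> Proj A B U \<and> V \<otimes>\<^sub>o\<^bsub>A\<^esub> P \<in> Proj A B U"
    if P: "P \<in> Proj A B U" and V: "V \<in> objects A" for P V
    using P
      relatively_projective_tensor_right
        [OF dual_pair_ldual[OF V] dual_pair_ldual[OF ldual_closed[OF V]]]
      relatively_projective_tensor_left
        [OF dual_pair_rdual[OF V] dual_pair_rdual[OF rdual_closed[OF V]]]
    unfolding Proj_def by blast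
  then show ?thesis
    unfolding tensor_ideal_def by (auto simp: Proj_def relatively_projective_def)
qed

text \<open>
  The zigzag identity of \<open>D\<close> factors its identity through \<open>D \<otimes> V \<otimes> D\<close>, and that of \<open>V\<close> factors
  through \<open>V \<otimes> D \<otimes> V\<close>.
\<close>

lemma (in monoidal_functor) Proj_dual_pair:
  assumes d: "dual_pair A V D e c" and ideal: "tensor_ideal A (Proj A B U)"
  shows "V \<in> Proj A B U \<longleftrightarrow> D \<in> Proj A B U"
proof
  from d have V: "V \<in> objects A" and D: "D \<in> objects A"
    and e: "e \<in> Hom A (D \<otimes>\<^sub>o\<^bsub>A\<^esub> V) (unit_obj A)" and c: "c \<in> Hom A (unit_obj A) (V \<otimes>\<^sub>o\<^bsub>A\<^esub> D)"
    and zzV: "(ident A V \<otimes>\<^sub>a\<^bsub>A\<^esub> e) \<cdot>\<^bsub>A\<^esub> (c \<otimes>\<^sub>a\<^bsub>A\<^esub> ident A V) = ident A V"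
    and zzD: "(e \<otimes>\<^sub>a\<^bsub>A\<^esub> ident A D) \<cdot>\<^bsub>A\<^esub> (ident A D \<otimes>\<^sub>a\<^bsub>A\<^esub> c) = ident A D"
    by (auto simp: dual_pair_def)
  have tensor: "P \<otimes>\<^sub>o\<^bsub>A\<^esub> W \<in> Proj A B U" "W \<otimes>\<^sub>o\<^bsub>A\<^esub> P \<in> Proj A B U"
    if "P \<in> Proj A B U" "W \<in> objects A" for P W
    using ideal that unfolding tensor_ideal_def by auto
  {
    assume "V \<in> Proj A B U"
    then have "relatively_projective A B U ((D \<otimes>\<^sub>o\<^bsub>A\<^esub> V) \<otimes>\<^sub>o\<^bsub>A\<^esub> D)"
      using tensor D unfolding Proj_def by blast
    moreover have "e \<otimes>\<^sub>a\<^bsub>A\<^esub> ident A D \<in> Hom A ((D \<otimes>\<^sub>o\<^bsub>A\<^esub> V) \<otimes>\<^sub>o\<^bsub>A\<^esub> D) D"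
      using A.tensor_arr_closed[OF e A.ident_closed[OF D]] by (simp add: A.unit_obj_left D)
    ultimately show "D \<in> Proj A B U"
      using relatively_projective_retract A.ident_tensor_coev_closed[OF d D] zzD
      unfolding Proj_def by blast
  next
    assume "D \<in> Proj A B U"
    then have "relatively_projective A B U ((V \<otimes>\<^sub>o\<^bsub>A\<^esub> D) \<otimes>\<^sub>o\<^bsub>A\<^esub> V)"
      using tensor V unfolding Proj_def by blast
    moreover have "c \<otimes>\<^sub>a\<^bsub>A\<^esub> ident A V \<in> Hom A V ((V \<otimes>\<^sub>o\<^bsub>A\<^esub> D) \<otimes>\<^sub>o\<^bsub>A\<^esub> V)"
      using A.tensor_arr_closed[OF c A.ident_closed[OF V]] by (simp add: A.unit_obj_left V)
    ultimately show "V \<in> Proj A B U"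
      using relatively_projective_retract A.ident_tensor_ev_closed[OF d V] zzV
      unfolding Proj_def by blast
  }
qed

theorem proposition3p2:
  fixes K :: "('k, 'r) ring_scheme"
    and A :: "('k, 'o, 'm, 'a) tensor_category_data_scheme"
    and B :: "('k, 'p, 'n, 'b) tensor_category_data_scheme"
    and U :: "('o, 'm, 'p, 'n, 'f) monoidal_functor_data_scheme"
  assumes "field K"
    and "tensor_category K A"
    and "tensor_category K B"
    and "monoidal_functor A B U"
    and "linear_functor K A B U"
    and "exact_functor A B U"
    and "faithful_functor A U"
    and "has_left_adjoint A B U"
  shows "tensor_ideal A (Proj A B U) \<and>
    (\<forall>P \<in> Proj A B U. ldual A P \<in> Proj A B U \<and> rdual A P \<in> Proj A B U)"
proof -
  interpret rigid_monoidal_category A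
    using \<open>tensor_category K A\<close> by (rule tensor_category.axioms)
  interpret monoidal_functor A B U by fact
  have ideal: "tensor_ideal A (Proj A B U)"
    by (rule tensor_ideal_Proj) unfold_locales
  moreover have "ldual A P \<in> Proj A B U \<and> rdual A P \<in> Proj A B U" if P: "P \<in> Proj A B U" for P
  proof -
    have "P \<in> objects A" using P by (simp add: Proj_def relatively_projective_def)
    then show ?thesis
      using P Proj_dual_pair[OF dual_pair_ldual ideal] Proj_dual_pair[OF dual_pair_rdual ideal]
      by blast
  qed
  ultimately show ?thesis by blast
qed

end
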